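(* Let $q$ be a prime power and let $Sp(2n,q)$ be the symplectic group acting naturally on $\mathbb{F}_q^{2n}$. Let $g$ be chosen uniformly at random from $Sp(2n,q)$ and let $Z_n$ be the number of vectors $v\in\mathbb{F}_q^{2n}$ with $gv=v$. Then for every natural number $j$ and every $n\ge j$, $$E[Z_n^j]=\prod_{i=1}^{j}\left(q^{i-1}+1\right).$$ *)

theory Defs
  imports
    "HOL-Probability.Probability_Mass_Function"
    "HOL-Number_Theory.Prime_Powers"
    "Jordan_Normal_Form.Matrix"
begin

text \<open>
  The finite field of order \<open>q\<close> is a type \<open>'a\<close> of sort \<open>{field, finite}\<close> with \<open>CARD('a) = q\<close>.
  \<open>J\<close> is the Gram matrix of the standard symplectic form on \<open>2 n\<close>-dimensional space. This form is
  alternating in every characteristic, including 2.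
\<close>

definition symplectic_J :: "nat \<Rightarrow> 'a :: field mat" where
  "symplectic_J n = four_block_mat (0\<^sub>m n n) (1\<^sub>m n) (- 1\<^sub>m n) (0\<^sub>m n n)"

definition Sp :: "nat \<Rightarrow> 'a :: field mat set" where
  "Sp n = {A \<in> carrier_mat (2 * n) (2 * n).
             transpose_mat A * symplectic_J n * A = symplectic_J n}"

definition num_fixed_vecs :: "nat \<Rightarrow> 'a :: field mat \<Rightarrow> nat" where
  "num_fixed_vecs n g = card {v \<in> carrier_vec (2 * n). g *\<^sub>v v = v}"

text \<open>
  \<open>pmf_of_set\<close> is the uniform distribution only on finite nonempty sets, and \<open>card\<close> is
  meaningful only on finite ones.
\<close>

lemma finite_carrier_vec: "finite (carrier_vec n :: 'a :: finite Matrix.vec set)"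
proof -
  have "carrier_vec n \<subseteq> vec_of_list ` {xs :: 'a list. set xs \<subseteq> UNIV \<and> length xs = n}"
  proof
    fix v :: "'a Matrix.vec" assume "v \<in> carrier_vec n"
    then have "length (list_of_vec v) = n" "v = vec_of_list (list_of_vec v)"
      by (auto simp: vec_list)
    then show "v \<in> vec_of_list ` {xs. set xs \<subseteq> UNIV \<and> length xs = n}" by blast
  qed
  then show ?thesis
    by (rule finite_surj[rotated]) (rule finite_lists_length_eq[OF finite_class.finite_UNIV])
qed

lemma finite_carrier_mat: "finite (carrier_mat m n :: 'a :: finite mat set)"
proof -
  have "carrier_mat m n \<subseteq>
    mat_of_rows n ` {xs :: 'a Matrix.vec list. set xs \<subseteq> carrier_vec n \<and> length xs = m}"
  proof
    fix A :: "'a mat" assume A: "A \<in> carrier_mat m n"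
    then have "A = mat_of_rows n (rows A)" "length (rows A) = m" "set (rows A) \<subseteq> carrier_vec n"
      using rows_carrier[of A] by auto
    then show "A \<in> mat_of_rows n ` {xs. set xs \<subseteq> carrier_vec n \<and> length xs = m}" by blast
  qed
  then show ?thesis
    by (rule finite_surj[rotated]) (rule finite_lists_length_eq[OF finite_carrier_vec])
qed

lemma finite_Sp: "finite (Sp n :: 'a :: {field, finite} mat set)"
  by (rule finite_subset[OF _ finite_carrier_mat]) (auto simp: Sp_def)

lemma symplectic_J_carrier: "symplectic_J n \<in> carrier_mat (2 * n) (2 * n)"
  by (simp add: symplectic_J_def mult_2)

lemma one_mat_in_Sp: "1\<^sub>m (2 * n) \<in> Sp n"
  by (simp add: Sp_def left_mult_one_mat[OF symplectic_J_carrier]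
      right_mult_one_mat[OF symplectic_J_carrier])

lemma Sp_nonempty: "Sp n \<noteq> {}"
  using one_mat_in_Sp by blast

end

theory Submission
  imports Defs "Berlekamp_Zassenhaus.Berlekamp_Type_Based"
begin

text \<open>
  For a subspace \<open>U\<close> let \<open>H\<close> be its pointwise stabiliser in \<open>Sp n\<close>. If \<open>card U * q ^ j \<le> q ^ n\<close>, then
  the sum of \<open>Z(h) ^ j\<close> over \<open>h \<in> H\<close> is \<open>card U ^ j * card H * (\<Prod>i<j. q ^ i + 1)\<close>; the theorem is
  the case \<open>U = 0\<close>. The induction on \<open>j\<close> writes one factor \<open>Z(h)\<close> as a sum over the vectors \<open>v\<close> fixed
  by \<open>h\<close> and applies the hypothesis to \<open>U + \<langle>v\<rangle>\<close>. The vectors in \<open>U\<close> contribute \<open>card U\<close> equal terms.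
  Outside \<open>U\<close>, the \<open>H\<close>-orbits are the fibres of the map that sends \<open>v\<close> to the functional \<open>u \<mapsto> (u, v)\<close> on
  \<open>U\<close> (the case of Witt's theorem needed here, by products of at most two transvections), and there are
  \<open>card U\<close> of them, which gives \<open>card U * card H\<close> pairs \<open>(h, v)\<close>.
\<close>

no_notation inner (infix "\<bullet>" 70)
no_notation vec_nth (infixl "$" 90)

no_notation inner (infix "\<bullet>" 70)
no_notation vec_nth (infixl "$" 90)

section \<open>The standard symplectic form\<close>

definition form :: "nat \<Rightarrow> 'a :: field Matrix.vec \<Rightarrow> 'a Matrix.vec \<Rightarrow> 'a" where
  "form n v w = v \<bullet> (symplectic_J n *\<^sub>v w)"

abbreviation space_V :: "nat \<Rightarrow> 'a :: field Matrix.vec set" where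
  "space_V n \<equiv> carrier_vec (2 * n)"

declare symplectic_J_carrier[simp]

lemma mult_mat_zero_vec:
  assumes "A \<in> carrier_mat r c" shows "A *\<^sub>v 0\<^sub>v c = 0\<^sub>v r"
  using assms by (intro eq_vecI) (auto simp: mult_mat_vec_def scalar_prod_def)

lemma J_dim[simp]: "dim_row (symplectic_J n) = 2 * n" "dim_col (symplectic_J n) = 2 * n"
  using symplectic_J_carrier by blast+

lemma J_vec_carrier[simp]: "w \<in> space_V n \<Longrightarrow> symplectic_J n *\<^sub>v w \<in> space_V n"
  by (rule mult_mat_vec_carrier[OF symplectic_J_carrier])

lemma form_add_left:
  "u \<in> space_V n \<Longrightarrow> v \<in> space_V n \<Longrightarrow> w \<in> space_V n \<Longrightarrow>
    form n (u + v) w = form n u w + form n v w"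
  unfolding form_def by (rule add_scalar_prod_distrib[where n = "2 * n"]) auto

lemma form_add_right:
  "u \<in> space_V n \<Longrightarrow> v \<in> space_V n \<Longrightarrow> w \<in> space_V n \<Longrightarrow>
    form n w (u + v) = form n w u + form n w v"
  unfolding form_def mult_add_distrib_mat_vec[OF symplectic_J_carrier]
  by (rule scalar_prod_add_distrib[where n = "2 * n"]) auto

lemma form_smult_left:
  "u \<in> space_V n \<Longrightarrow> w \<in> space_V n \<Longrightarrow> form n (a \<cdot>\<^sub>v u) w = a * form n u w"
  unfolding form_def by (rule smult_scalar_prod_distrib[where n = "2 * n"]) auto

lemma form_smult_right:
  "u \<in> space_V n \<Longrightarrow> w \<in> space_V n \<Longrightarrow> form n w (a \<cdot>\<^sub>v u) = a * form n w u"
  unfolding form_def mult_mat_vec[OF symplectic_J_carrier]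
  by (rule scalar_prod_smult_distrib[where n = "2 * n"]) auto

lemma J_append:
  assumes "x \<in> carrier_vec n" "y \<in> carrier_vec n"
  shows "symplectic_J n *\<^sub>v (x @\<^sub>v y) = y @\<^sub>v - x"
  unfolding symplectic_J_def using assms
  by (subst four_block_mat_mult_vec[of _ n n _ n _ n])
    auto

lemma space_V_split:
  assumes "v \<in> space_V n"
  obtains x y where "x \<in> carrier_vec n" "y \<in> carrier_vec n" "v = x @\<^sub>v y"
  by (metis assms mult_2 vec_first_carrier vec_first_last_append vec_last_carrier)

text \<open>In the halves \<open>x\<close>, \<open>y\<close> of \<open>v\<close> the form is
  \<open>x \<bullet> y - y \<bullet> x\<close>, so it vanishes by commutativity, without division by
  2. Skew-symmetry is derived from this by polarisation, which keeps characteristic 2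
  covered.\<close>

lemma form_self:
  assumes "v \<in> space_V n" shows "form n v v = 0"
proof -
  obtain x y where xy: "x \<in> carrier_vec n" "y \<in> carrier_vec n" "v = x @\<^sub>v y"
    using space_V_split[OF assms] .
  then have "form n v v = x \<bullet> y + y \<bullet> (- x)"
    by (simp add: form_def J_append scalar_prod_append[of _ n _ n])
  also have "y \<bullet> (- x) = - (x \<bullet> y)"
    using xy by (simp add: comm_scalar_prod[of x n y])
  finally show ?thesis by simp
qed

lemma form_skew:
  assumes "v \<in> space_V n" "w \<in> space_V n" shows "form n w v = - form n v w"
proof -
  have "0 = form n (v + w) (v + w)" using assms by (simp add: form_self)
  also have "\<dots> = form n v w + form n w v"
    using assms by (simp add: form_add_left form_add_right form_self[OF assms(1)] form_self[OF assms(2)])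
  finally show ?thesis by (metis add.commute eq_neg_iff_add_eq_0)
qed

lemma J_J_vec:
  assumes "v \<in> space_V n" shows "symplectic_J n *\<^sub>v (symplectic_J n *\<^sub>v v) = - v"
proof -
  obtain x y where xy: "x \<in> carrier_vec n" "y \<in> carrier_vec n" "v = x @\<^sub>v y"
    using space_V_split[OF assms] .
  then show ?thesis by (auto simp: J_append)
qed

lemma vec_eqI_scalar_prod:
  fixes u v :: "'a :: field Matrix.vec"
  assumes "u \<in> carrier_vec d" "v \<in> carrier_vec d"
    and "\<And>w. w \<in> carrier_vec d \<Longrightarrow> w \<bullet> u = w \<bullet> v"
  shows "u = v"
proof
  fix i assume "i < dim_vec v"
  then show "u $ i = v $ i" using assms(1,2) assms(3)[of "unit_vec d i"] by simp
qed (use assms in auto)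

text \<open>Testing against all \<open>w\<close> forces \<open>symplectic_J n *\<^sub>v u\<close> to
  be zero, and a second application of \<open>symplectic_J n\<close> recovers
  \<open>- u\<close>.\<close>

lemma form_nondegenerate:
  assumes u: "u \<in> space_V n" and 0: "\<And>w. w \<in> space_V n \<Longrightarrow> form n w u = 0"
  shows "u = 0\<^sub>v (2 * n)"
proof -
  have "symplectic_J n *\<^sub>v u = 0\<^sub>v (2 * n)"
    using 0 u by (intro vec_eqI_scalar_prod[where d = "2 * n"]) (auto simp: form_def)
  then have "- u = symplectic_J n *\<^sub>v 0\<^sub>v (2 * n)" using J_J_vec[OF u] by simp
  also have "\<dots> = 0\<^sub>v (2 * n)"
    by (rule mult_mat_zero_vec) simp
  finally show ?thesis using u by (metis uminus_uminus_vec uminus_zero_vec)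
qed

section \<open>The symplectic group as the isometries of the form\<close>

lemma form_Sp:
  assumes "A \<in> carrier_mat (2 * n) (2 * n)" "v \<in> space_V n" "w \<in> space_V n"
  shows "form n (A *\<^sub>v v) (A *\<^sub>v w) = v \<bullet> ((transpose_mat A * symplectic_J n * A) *\<^sub>v w)"
proof -
  have 1: "(transpose_mat A * symplectic_J n * A) *\<^sub>v w =
    transpose_mat A *\<^sub>v (symplectic_J n *\<^sub>v (A *\<^sub>v w))"
    using assms by (simp add: assoc_mult_mat_vec[of _ "2 * n" "2 * n" _ "2 * n"])
  have "form n (A *\<^sub>v v) (A *\<^sub>v w) = (symplectic_J n *\<^sub>v (A *\<^sub>v w)) \<bullet> (A *\<^sub>v v)"
    unfolding form_def using assms by (intro comm_scalar_prod[of _ "2 * n"]) auto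
  also have "\<dots> = (transpose_mat A *\<^sub>v (symplectic_J n *\<^sub>v (A *\<^sub>v w))) \<bullet> v"
    using assms by (intro transpose_vec_mult_scalar[symmetric, of _ "2 * n" "2 * n"]) auto
  also have "\<dots> = v \<bullet> (transpose_mat A *\<^sub>v (symplectic_J n *\<^sub>v (A *\<^sub>v w)))"
    using assms by (intro comm_scalar_prod[of _ "2 * n"]) auto
  finally show ?thesis by (simp add: 1)
qed

lemma mat_eqI_mult_vec:
  fixes A B :: "'a :: field mat"
  assumes "A \<in> carrier_mat d e" "B \<in> carrier_mat d e"
    and "\<And>v. v \<in> carrier_vec e \<Longrightarrow> A *\<^sub>v v = B *\<^sub>v v"
  shows "A = B"
proof
  fix i j assume "i < dim_row B" "j < dim_col B"
  then show "A $$ (i, j) = B $$ (i, j)"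
    using assms(1,2) arg_cong[OF assms(3)[of "unit_vec e j"], of "\<lambda>x. x $ i"] by auto
qed (use assms in auto)

text \<open>By \<open>form_Sp\<close> the matrix equation compares two Gram matrices, and a Gram
  matrix is determined by its values on all pairs of vectors.\<close>

lemma Sp_iff:
  "A \<in> Sp n \<longleftrightarrow> A \<in> carrier_mat (2 * n) (2 * n) \<and>
    (\<forall>v \<in> space_V n. \<forall>w \<in> space_V n. form n (A *\<^sub>v v) (A *\<^sub>v w) = form n v w)"
  (is "_ \<longleftrightarrow> ?C \<and> ?P")
proof (cases ?C)
  case C: True
  have "?P" if "A \<in> Sp n"
    using that form_Sp[OF C] by (auto simp: Sp_def form_def)
  moreover have "A \<in> Sp n" if ?P
  proof -
    have "transpose_mat A * symplectic_J n * A = symplectic_J n"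
    proof (rule mat_eqI_mult_vec)
      fix w :: "'a Matrix.vec" assume w: "w \<in> space_V n"
      show "(transpose_mat A * symplectic_J n * A) *\<^sub>v w = symplectic_J n *\<^sub>v w"
      proof (rule vec_eqI_scalar_prod)
        fix v :: "'a Matrix.vec" assume v: "v \<in> space_V n"
        show "v \<bullet> ((transpose_mat A * symplectic_J n * A) *\<^sub>v w) = v \<bullet> (symplectic_J n *\<^sub>v w)"
          using that v w by (metis form_Sp[OF C] form_def)
      next
        show "(transpose_mat A * symplectic_J n * A) *\<^sub>v w \<in> space_V n"
          by (rule mult_mat_vec_carrier[where n = "2 * n"])
            (use C w in \<open>auto intro!: mult_carrier_mat[of _ _ "2 * n"]\<close>)
      qed (use w in simp)
    qed (use C in \<open>auto intro!: mult_carrier_mat[of _ _ "2 * n"]\<close>)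
    then show ?thesis using C by (simp add: Sp_def)
  qed
  ultimately show ?thesis using C by blast
qed (simp add: Sp_def)

lemma Sp_carrier: "A \<in> Sp n \<Longrightarrow> A \<in> carrier_mat (2 * n) (2 * n)"
  by (simp add: Sp_def)

lemma Sp_vec[simp]: "A \<in> Sp n \<Longrightarrow> v \<in> space_V n \<Longrightarrow> A *\<^sub>v v \<in> space_V n"
  by (rule mult_mat_vec_carrier[OF Sp_carrier])

lemma Sp_form: "A \<in> Sp n \<Longrightarrow> v \<in> space_V n \<Longrightarrow> w \<in> space_V n \<Longrightarrow> form n (A *\<^sub>v v) (A *\<^sub>v w) = form n v w"
  by (simp add: Sp_iff)

lemma Sp_mult_vec:
  "A \<in> Sp n \<Longrightarrow> B \<in> Sp n \<Longrightarrow> v \<in> space_V n \<Longrightarrow> (A * B) *\<^sub>v v = A *\<^sub>v (B *\<^sub>v v)"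
  by (rule assoc_mult_mat_vec[OF Sp_carrier Sp_carrier])

lemma Sp_mult:
  assumes "A \<in> Sp n" "B \<in> Sp n" shows "A * B \<in> Sp n"
  using assms mult_carrier_mat[OF Sp_carrier Sp_carrier, OF assms]
  by (simp add: Sp_iff[of "A * B"] Sp_mult_vec Sp_form)

text \<open>Since \<open>J * J = - 1\<close>, the equation \<open>A^T * J * A = J\<close> exhibits
  \<open>- (J * A^T * J)\<close> as a left inverse, hence as a two-sided one because the matrices
  are square. It serves only for cancellation, so its membership in \<open>Sp n\<close> is not
  claimed.\<close>

lemma Sp_inverse:
  assumes "A \<in> Sp n"
  obtains B where "B \<in> carrier_mat (2 * n) (2 * n)" "B * A = 1\<^sub>m (2 * n)" "A * B = 1\<^sub>m (2 * n)"
proof -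
  let ?J = "symplectic_J n :: 'a mat"
  define B where "B = - (?J * transpose_mat A * ?J)"
  have C: "A \<in> carrier_mat (2 * n) (2 * n)" using assms by (rule Sp_carrier)
  have B: "B \<in> carrier_mat (2 * n) (2 * n)"
    unfolding B_def using C by (auto intro!: mult_carrier_mat[of _ _ "2 * n"])
  have "B * A = 1\<^sub>m (2 * n)"
  proof (rule mat_eqI_mult_vec)
    fix v :: "'a Matrix.vec" assume v: "v \<in> space_V n"
    have 1: "?J * transpose_mat A * ?J \<in> carrier_mat (2 * n) (2 * n)"
      using C by (auto intro!: mult_carrier_mat[of _ _ "2 * n"])
    have "?J * transpose_mat A * ?J * A = ?J * (transpose_mat A * ?J * A)"
      using C by (simp add: assoc_mult_mat[of _ "2 * n" "2 * n" _ "2 * n" _ "2 * n"]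
          mult_carrier_mat[of _ "2 * n" "2 * n"])
    then have "B * A = - (?J * (transpose_mat A * ?J * A))"
      unfolding B_def using C 1 by (subst uminus_mult_left_mat) auto
    also have "\<dots> = - (?J * ?J)" using assms by (simp add: Sp_def)
    also have "\<dots> *\<^sub>v v = - (?J *\<^sub>v (?J *\<^sub>v v))"
      using v by (simp add: assoc_mult_mat_vec[of _ "2 * n" "2 * n" _ "2 * n"])
    finally show "(B * A) *\<^sub>v v = 1\<^sub>m (2 * n) *\<^sub>v v" using v by (simp add: J_J_vec)
  qed (use B C in \<open>auto intro!: mult_carrier_mat[of _ _ "2 * n"]\<close>)
  with B C show thesis using that mat_mult_left_right_inverse by blast
qed

lemma Sp_vec_inj:
  assumes "A \<in> Sp n" "v \<in> space_V n" "w \<in> space_V n" "A *\<^sub>v v = A *\<^sub>v w"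
  shows "v = w"
proof -
  obtain B where B: "B \<in> carrier_mat (2 * n) (2 * n)" "B * A = 1\<^sub>m (2 * n)"
    using Sp_inverse[OF assms(1)] by metis
  have "(B * A) *\<^sub>v v = (B * A) *\<^sub>v w"
    using assms by (simp only: assoc_mult_mat_vec[OF B(1) Sp_carrier[OF assms(1)]])
  then show ?thesis using assms(2,3) by (simp add: B(2))
qed

lemma Sp_mult_right_inj:
  assumes "A \<in> Sp n" "B \<in> Sp n" "C \<in> Sp n" "A * C = B * C"
  shows "A = B"
proof -
  obtain D where D: "D \<in> carrier_mat (2 * n) (2 * n)" "C * D = 1\<^sub>m (2 * n)"
    using Sp_inverse[OF assms(3)] by metis
  have "A * (C * D) = A * C * D" "B * (C * D) = B * C * D"
    using assms(1-3)[THEN Sp_carrier] D(1) by (simp_all only: assoc_mult_mat)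
  then have "A * (C * D) = B * (C * D)" by (simp only: assms(4))
  then show ?thesis using assms(1,2)[THEN Sp_carrier] by (simp add: D(2))
qed

section \<open>Transvections\<close>

text \<open>The map is the identity plus the rank-one matrix \<open>a * c * l^T\<close> with
  \<open>l = J c\<close>. It is an isometry because the two cross terms
  \<open>a * (v, c) * (c, w)\<close> and \<open>a * (w, c) * (v, c)\<close> cancel by skew-symmetry,
  and the quadratic term contains \<open>(c, c) = 0\<close>.\<close>

lemma transvection:
  assumes c: "c \<in> space_V n"
  obtains A where "A \<in> Sp n" "\<And>x. x \<in> space_V n \<Longrightarrow> A *\<^sub>v x = x + (a * form n x c) \<cdot>\<^sub>v c"
proof -
  define l where "l = symplectic_J n *\<^sub>v c"
  define A where "A = 1\<^sub>m (2 * n) + Matrix.mat (2 * n) (2 * n) (\<lambda>(i, j). a * c $ i * l $ j)"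
  have l: "l \<in> space_V n" unfolding l_def using c by simp
  have A: "A \<in> carrier_mat (2 * n) (2 * n)" by (simp add: A_def)
  have Av: "A *\<^sub>v x = x + (a * form n x c) \<cdot>\<^sub>v c" if x: "x \<in> space_V n" for x
  proof -
    have "Matrix.mat (2 * n) (2 * n) (\<lambda>(i, j). a * c $ i * l $ j) *\<^sub>v x = (a * form n x c) \<cdot>\<^sub>v c"
      using c l x
      by (intro eq_vecI) (auto simp: form_def l_def[symmetric] scalar_prod_def sum_distrib_left sum_distrib_right
        intro!: sum.cong)
    then show ?thesis using x by (simp add: A_def add_mult_distrib_mat_vec[of _ "2 * n" "2 * n"])
  qed
  have "form n (A *\<^sub>v v) (A *\<^sub>v w) = form n v w" if "v \<in> space_V n" "w \<in> space_V n" for v w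
    using that c
    by (simp add: Av form_add_left form_add_right form_smult_left form_smult_right form_self
        form_skew[OF that(2) c] algebra_simps)
  with A have "A \<in> Sp n" by (simp add: Sp_iff)
  with Av that show thesis by blast
qed

section \<open>Subspaces and their cardinalities\<close>

definition lin_subspace :: "nat \<Rightarrow> 'a :: field Matrix.vec set \<Rightarrow> bool" where
  "lin_subspace d U \<longleftrightarrow> U \<subseteq> carrier_vec d \<and> 0\<^sub>v d \<in> U \<and>
    (\<forall>u\<in>U. \<forall>v\<in>U. u + v \<in> U) \<and> (\<forall>a. \<forall>u\<in>U. a \<cdot>\<^sub>v u \<in> U)"

lemma lin_subspaceD:
  assumes "lin_subspace d U"
  shows "u \<in> U \<Longrightarrow> u \<in> carrier_vec d" "0\<^sub>v d \<in> U"
    "u \<in> U \<Longrightarrow> v \<in> U \<Longrightarrow> u + v \<in> U" "u \<in> U \<Longrightarrow> a \<cdot>\<^sub>v u \<in> U"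
  using assms by (auto simp: lin_subspace_def)

lemma lin_subspace_finite:
  "lin_subspace d (U :: 'a :: {field, finite} Matrix.vec set) \<Longrightarrow> finite U"
  by (auto simp: lin_subspace_def intro: finite_subset[OF _ finite_carrier_vec])

text \<open>A nonzero functional takes the value 1 at some \<open>u1\<close>, and \<open>U\<close>
  is then the direct sum of the kernel and the line through \<open>u1\<close>.\<close>

lemma card_functional_kernel:
  fixes U :: "'a :: {field, finite} Matrix.vec set"
  assumes U: "lin_subspace d U"
    and add: "\<And>u v. u \<in> U \<Longrightarrow> v \<in> U \<Longrightarrow> f (u + v) = f u + f v"
    and smult: "\<And>a u. u \<in> U \<Longrightarrow> f (a \<cdot>\<^sub>v u) = a * f u"
    and ne: "e \<in> U" "f e \<noteq> (0 :: 'a)"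
  shows "CARD('a) * card {u \<in> U. f u = 0} = card U"
proof -
  note [simp] = lin_subspaceD[OF U]
  define u1 where "u1 = (1 / f e) \<cdot>\<^sub>v e"
  have u1[simp]: "u1 \<in> U" "f u1 = 1" using ne by (simp_all add: u1_def smult)
  have c: "dim_vec u = d" if "u \<in> U" for u using lin_subspaceD(1)[OF U that] by simp
  have "bij_betw (\<lambda>(u, a). u + a \<cdot>\<^sub>v u1) ({u \<in> U. f u = 0} \<times> UNIV) U"
    by (rule bij_betw_byWitness[where f' = "\<lambda>u. (u + (- f u) \<cdot>\<^sub>v u1, f u)"])
      (auto simp: add smult c intro!: eq_vecI)
  then have "card ({u \<in> U. f u = 0} \<times> (UNIV :: 'a set)) = card U"
    by (rule bij_betw_same_card)
  then show ?thesis by (simp add: card_cartesian_product mult.commute)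
qed

definition adjoin :: "'a :: field Matrix.vec set \<Rightarrow> 'a Matrix.vec \<Rightarrow> 'a Matrix.vec set" where
  "adjoin U v = (\<lambda>(u, a). u + a \<cdot>\<^sub>v v) ` (U \<times> UNIV)"

lemma adjoinI: "u \<in> U \<Longrightarrow> x = u + a \<cdot>\<^sub>v v \<Longrightarrow> x \<in> adjoin U v"
  unfolding adjoin_def by (rule image_eqI[where x = "(u, a)"]) auto

lemma adjoin_subspace:
  assumes U: "lin_subspace d U" and v: "v \<in> carrier_vec d"
  shows "lin_subspace d (adjoin U v)"
proof -
  note D = lin_subspaceD[OF U]
  have c: "dim_vec u = d" if "u \<in> U" for u using D(1)[OF that] by simp
  have "0\<^sub>v d = 0\<^sub>v d + 0 \<cdot>\<^sub>v v" using v by (intro eq_vecI) auto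
  with D(2) have "0\<^sub>v d \<in> adjoin U v" by (rule adjoinI)
  moreover have "x + y \<in> adjoin U v" if xy: "x \<in> adjoin U v" "y \<in> adjoin U v" for x y
  proof -
    obtain u a u' b where *: "x = u + a \<cdot>\<^sub>v v" "u \<in> U" "y = u' + b \<cdot>\<^sub>v v" "u' \<in> U"
      using xy unfolding adjoin_def by auto
    have "x + y = (u + u') + (a + b) \<cdot>\<^sub>v v"
      using * v by (intro eq_vecI) (auto simp: c algebra_simps)
    with D(3)[OF *(2,4)] show ?thesis by (rule adjoinI)
  qed
  moreover have "b \<cdot>\<^sub>v x \<in> adjoin U v" if x: "x \<in> adjoin U v" for x b
  proof -
    obtain u a where *: "x = u + a \<cdot>\<^sub>v v" "u \<in> U" using x unfolding adjoin_def by auto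
    have "b \<cdot>\<^sub>v x = b \<cdot>\<^sub>v u + (b * a) \<cdot>\<^sub>v v"
      using * v by (intro eq_vecI) (auto simp: c algebra_simps)
    with D(4)[OF *(2)] show ?thesis by (rule adjoinI)
  qed
  moreover have "adjoin U v \<subseteq> carrier_vec d" using v by (auto simp: adjoin_def D(1))
  ultimately show ?thesis by (simp add: lin_subspace_def)
qed

lemma adjoin_member:
  assumes U: "lin_subspace d U" and v: "v \<in> U"
  shows "adjoin U v = U"
proof -
  note D = lin_subspaceD[OF U]
  have "u \<in> adjoin U v" if "u \<in> U" for u
  proof -
    have "u = u + 0 \<cdot>\<^sub>v v" using D(1)[OF that] D(1)[OF v] by (intro eq_vecI) auto
    with that show ?thesis by (rule adjoinI)
  qed
  then show ?thesis using D(3,4) v by (auto simp: adjoin_def)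
qed

lemma card_adjoin:
  fixes U :: "'a :: {field, finite} Matrix.vec set"
  assumes U: "lin_subspace d U" and v: "v \<in> carrier_vec d" "v \<notin> U"
  shows "card (adjoin U v) = CARD('a) * card U"
proof -
  note D = lin_subspaceD[OF U]
  have c: "dim_vec u = d" if "u \<in> U" for u using D(1)[OF that] by simp
  have ab: "a = b" if u: "u \<in> U" "u' \<in> U" and eq: "u + a \<cdot>\<^sub>v v = u' + b \<cdot>\<^sub>v v" for u u' a b
  proof (rule ccontr)
    assume ne: "a \<noteq> b"
    \<comment> \<open>Two representations with different coefficients could be solved for
      \<open>v\<close>, which would put \<open>v\<close> in \<open>U\<close>.\<close>
    have "v = (1 / (a - b)) \<cdot>\<^sub>v (u' + (- 1) \<cdot>\<^sub>v u)"
    proof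
      fix i assume "i < dim_vec ((1 / (a - b)) \<cdot>\<^sub>v (u' + (- 1) \<cdot>\<^sub>v u))"
      then have i: "i < d" using c u by simp
      have "(u + a \<cdot>\<^sub>v v) $ i = (u' + b \<cdot>\<^sub>v v) $ i" by (simp only: eq)
      then have "u $ i + a * v $ i = u' $ i + b * v $ i" using i u v c by simp
      then have "v $ i = (u' $ i - u $ i) / (a - b)" using ne by (simp add: field_simps)
      then show "v $ i = ((1 / (a - b)) \<cdot>\<^sub>v (u' + (- 1) \<cdot>\<^sub>v u)) $ i" using i u c by simp
    qed (use u v c in auto)
    also have "\<dots> \<in> U" using u D(3,4) by blast
    finally show False using v by simp
  qed
  have uu: "u = u'" if u: "u \<in> U" "u' \<in> U" and eq: "u + a \<cdot>\<^sub>v v = u' + a \<cdot>\<^sub>v v" for u u' a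
  proof
    fix i assume "i < dim_vec u'"
    then have i: "i < d" using c u by simp
    have "(u + a \<cdot>\<^sub>v v) $ i = (u' + a \<cdot>\<^sub>v v) $ i" by (simp only: eq)
    then show "u $ i = u' $ i" using i u v c by simp
  qed (use u c in auto)
  have "inj_on (\<lambda>(u, a). u + a \<cdot>\<^sub>v v) (U \<times> UNIV)"
    unfolding inj_on_def using ab uu by (metis (no_types, lifting) mem_Sigma_iff case_prod_conv surj_pair)
  then show ?thesis
    unfolding adjoin_def by (simp add: card_image card_cartesian_product mult.commute)
qed

lemma space_V_subspace: "lin_subspace (2 * n) (space_V n)"
  by (auto simp: lin_subspace_def)

section \<open>Orthogonal complements\<close>

definition perp :: "nat \<Rightarrow> 'a :: field Matrix.vec set \<Rightarrow> 'a Matrix.vec set" where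
  "perp n U = {w \<in> space_V n. \<forall>u \<in> U. form n w u = 0}"

lemma perp_subspace:
  assumes "U \<subseteq> space_V n" shows "lin_subspace (2 * n) (perp n U)"
proof -
  have "form n (0\<^sub>v (2 * n)) u = 0" if "u \<in> space_V n" for u :: "'a Matrix.vec"
    using that by (simp add: form_def scalar_prod_def)
  then show ?thesis
    using assms by (auto simp: lin_subspace_def perp_def form_add_left form_smult_left subset_iff)
qed

text \<open>The equation says \<open>(q - 1) * (u * p - v) = 0\<close>. Substituting for
  \<open>v\<close> and \<open>u\<close> removes the truncated subtractions before passing to
  integers.\<close>

lemma double_count_cancel:
  fixes p q u v :: nat
  assumes "p * (q * u) + (v - p) * u = q * v + (u - 1) * v" "p \<le> v" "1 \<le> u" "1 < q"
  shows "u * p = v"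
proof -
  obtain k m where [simp]: "v = p + k" "u = Suc m"
    using assms(2,3) by (metis le_iff_add plus_1_eq_Suc)
  have "int (p * (q * u) + k * u) = int (q * v + m * v)"
    using assms(1) by simp
  then have "(int q - 1) * (int (u * p) - int v) = 0"
    by (simp add: algebra_simps)
  then have "int (u * p) = int v" using assms(4) by simp
  then show ?thesis by (simp only: of_nat_eq_iff)
qed

text \<open>Double counting of the orthogonal pairs in \<open>U \<times> V\<close> replaces dimension theory.\<close>

lemma card_perp:
  fixes U :: "'a :: {field, finite} Matrix.vec set"
  assumes U: "lin_subspace (2 * n) U"
  shows "card U * card (perp n U) = CARD('a) ^ (2 * n)"
proof -
  let ?q = "CARD('a)" and ?V = "space_V n :: 'a Matrix.vec set" and ?z = "0\<^sub>v (2 * n)"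
  note D = lin_subspaceD[OF U]
  have fin: "finite U" "finite ?V" using lin_subspace_finite[OF U] finite_carrier_vec by auto
  have cV: "card ?V = ?q ^ (2 * n)" by (rule card_carrier_vec)
  have perp: "perp n U \<subseteq> ?V" by (auto simp: perp_def)
  \<comment> \<open>Pairs counted by \<open>w\<close>: the functional \<open>(w, -)\<close> on
    \<open>U\<close> is zero exactly for \<open>w\<close> in \<open>perp n U\<close>, and otherwise
    its kernel is a \<open>q\<close>-th part of \<open>U\<close>. The factor \<open>q\<close> is
    kept on the left to avoid division.\<close>
  have A: "?q * card {u \<in> U. form n w u = 0} = (if w \<in> perp n U then ?q * card U else card U)"
    if w: "w \<in> ?V" for w
  proof (cases "w \<in> perp n U")
    case True
    then have "{u \<in> U. form n w u = 0} = U" by (auto simp: perp_def)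
    then show ?thesis using True by simp
  next
    case False
    then obtain u0 where "u0 \<in> U" "form n w u0 \<noteq> 0" using w by (auto simp: perp_def)
    with False show ?thesis
      using card_functional_kernel[OF U, where f = "form n w" and e = u0] w D(1)
      by (simp add: form_add_right form_smult_right)
  qed
  \<comment> \<open>Pairs counted by \<open>u\<close>: by nondegeneracy only \<open>u = 0\<close> is
    orthogonal to the whole space.\<close>
  have B: "?q * card {w \<in> ?V. form n w u = 0} = (if u = ?z then ?q * card ?V else card ?V)"
    if u: "u \<in> U" for u
  proof (cases "u = ?z")
    case True
    have "form n w ?z = 0" if "w \<in> ?V" for w
      using that form_skew[of ?z n w] lin_subspaceD(2)[OF perp_subspace[of ?V n]]
      by (simp add: perp_def)
    then have "{w \<in> ?V. form n w u = 0} = ?V" using True by blast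
    then show ?thesis using True by simp
  next
    case False
    then obtain w0 where "w0 \<in> ?V" "form n w0 u \<noteq> 0"
      using form_nondegenerate[OF D(1)[OF u]] by blast
    with False show ?thesis
      using card_functional_kernel[OF space_V_subspace, where f = "\<lambda>w. form n w u" and e = w0] D(1)[OF u]
      by (simp add: form_add_left form_smult_left)
  qed
  have "(\<Sum>w\<in>?V. card {u \<in> U. form n w u = 0}) = (\<Sum>u\<in>U. card {w \<in> ?V. form n w u = 0})"
    using sum.swap_restrict[OF fin(2,1), of "\<lambda>_ _. 1 :: nat" "\<lambda>w u. form n w u = 0"] by simp
  then have "(\<Sum>w\<in>?V. ?q * card {u \<in> U. form n w u = 0}) = (\<Sum>u\<in>U. ?q * card {w \<in> ?V. form n w u = 0})"
    by (simp only: sum_distrib_left[symmetric])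
  then have "(\<Sum>w\<in>?V. if w \<in> perp n U then ?q * card U else card U) =
      (\<Sum>u\<in>U. if u = ?z then ?q * card ?V else card ?V)"
    by (simp only: A B cong: sum.cong)
  also have "(\<Sum>w\<in>?V. if w \<in> perp n U then ?q * card U else card U) =
      card (perp n U) * (?q * card U) + card (?V - perp n U) * card U"
    using fin perp by (simp add: sum.If_cases Int_absorb1 Diff_eq)
  also have "card (?V - perp n U) = card ?V - card (perp n U)"
    using perp fin by (simp add: card_Diff_subset finite_subset)
  also have "(\<Sum>u\<in>U. if u = ?z then ?q * card ?V else card ?V) = ?q * card ?V + (card U - 1) * card ?V"
    using fin D(2) by (simp add: sum.remove)
  finally have eq: "card (perp n U) * (?q * card U) + (card ?V - card (perp n U)) * card U =
      ?q * card ?V + (card U - 1) * card ?V" .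
  have "card (perp n U) \<le> card ?V" "1 \<le> card U"
    using perp fin D(2) by (auto intro!: card_mono simp: Suc_le_eq card_gt_0_iff)
  moreover have "?q > 1" using card_mono[of "UNIV :: 'a set" "{0, 1}"] by simp
  ultimately have "card U * card (perp n U) = card ?V"
    using double_count_cancel[OF eq] by simp
  then show ?thesis by (simp only: cV)
qed

text \<open>One inclusion is skew-symmetry. Equality follows by applying \<open>card_perp\<close> to
  both \<open>U\<close> and \<open>perp n U\<close>.\<close>

lemma perp_perp:
  fixes U :: "'a :: {field, finite} Matrix.vec set"
  assumes U: "lin_subspace (2 * n) U"
  shows "perp n (perp n U) = U"
proof (rule card_subset_eq[symmetric])
  have UV: "U \<subseteq> space_V n" using U by (simp add: lin_subspace_def)
  have W: "lin_subspace (2 * n) (perp n U)" by (rule perp_subspace[OF UV])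
  show "finite (perp n (perp n U))"
    by (rule finite_subset[OF _ finite_carrier_vec]) (auto simp: perp_def)
  show "U \<subseteq> perp n (perp n U)"
    using UV form_skew by (fastforce simp: perp_def)
  have "card (perp n U) * card U = card (perp n U) * card (perp n (perp n U))"
    using card_perp[OF U] card_perp[OF W] by (simp add: mult.commute)
  moreover have "card (perp n U) > 0"
    using lin_subspaceD(2)[OF W] lin_subspace_finite[OF W] by (auto simp: card_gt_0_iff)
  ultimately show "card U = card (perp n (perp n U))" by simp
qed

section \<open>Pointwise stabilisers and transitivity\<close>

definition stab :: "nat \<Rightarrow> 'a :: field Matrix.vec set \<Rightarrow> 'a mat set" where
  "stab n U = {A \<in> Sp n. \<forall>u \<in> U. A *\<^sub>v u = u}"

lemma stab_finite: "finite (stab n (U :: 'a :: {field, finite} Matrix.vec set))"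
  by (rule finite_subset[OF _ finite_Sp]) (auto simp: stab_def)

lemma stab_mult:
  assumes "A \<in> stab n U" "B \<in> stab n U" "U \<subseteq> space_V n"
  shows "A * B \<in> stab n U"
  using assms by (auto simp: stab_def Sp_mult Sp_mult_vec subset_iff)

lemma stab_insert: "stab n (insert v U) = {A \<in> stab n U. A *\<^sub>v v = v}"
  by (auto simp: stab_def)

text \<open>The vectors fixed by a matrix form a subspace. This links the subspace
  \<open>adjoin U v\<close>, to which the induction applies, with \<open>insert v U\<close>, which
  describes the stabiliser of \<open>v\<close> in \<open>stab n U\<close>.\<close>

lemma stab_adjoin:
  assumes U: "lin_subspace (2 * n) U" and v: "v \<in> space_V n"
  shows "stab n (adjoin U v) = stab n (insert v U)"
proof -
  note D = lin_subspaceD[OF U]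
  have "v = 0\<^sub>v (2 * n) + 1 \<cdot>\<^sub>v v" using v by (intro eq_vecI) auto
  with D(2) have 1: "v \<in> adjoin U v" by (rule adjoinI)
  have 2: "u \<in> adjoin U v" if "u \<in> U" for u
  proof -
    have "u = u + 0 \<cdot>\<^sub>v v" using D(1)[OF that] v by (intro eq_vecI) auto
    with that show ?thesis by (rule adjoinI)
  qed
  have "A *\<^sub>v (u + a \<cdot>\<^sub>v v) = u + a \<cdot>\<^sub>v v"
    if "A \<in> stab n (insert v U)" "u \<in> U" for A u a
  proof -
    have A: "A \<in> carrier_mat (2 * n) (2 * n)" "A *\<^sub>v v = v" "A *\<^sub>v u = u"
      using that by (auto simp: stab_def Sp_carrier)
    then show ?thesis
      using D(1)[OF that(2)] v
      by (simp add: mult_add_distrib_mat_vec[OF A(1)] mult_mat_vec[OF A(1)])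
  qed
  then have "stab n (insert v U) \<subseteq> stab n (adjoin U v)"
    by (auto simp: adjoin_def stab_def)
  moreover have "stab n (adjoin U v) \<subseteq> stab n (insert v U)"
    using 1 2 by (auto simp: stab_def)
  ultimately show ?thesis by blast
qed

text \<open>The transvection along \<open>c = w - v\<close> with coefficient
  \<open>1 / (v, w)\<close> fixes \<open>U\<close> because \<open>(u, c) = 0\<close>, and sends
  \<open>v\<close> to \<open>v + c = w\<close> because \<open>(v, c) = (v, w)\<close>.\<close>

lemma stab_moves_if_not_orthogonal:
  assumes U: "U \<subseteq> space_V n" and v: "v \<in> space_V n" and w: "w \<in> space_V n"
    and eq: "\<And>u. u \<in> U \<Longrightarrow> form n u v = form n u w" and ne: "form n v w \<noteq> 0"
  shows "\<exists>A \<in> stab n U. A *\<^sub>v v = w"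
proof -
  define c where "c = w + (- 1) \<cdot>\<^sub>v v"
  have c: "c \<in> space_V n" using v w by (simp add: c_def)
  have fc: "form n x c = form n x w - form n x v" if "x \<in> space_V n" for x
    using that v w by (simp add: c_def form_add_right form_smult_right)
  obtain A where A: "A \<in> Sp n"
    "\<And>x. x \<in> space_V n \<Longrightarrow> A *\<^sub>v x = x + (1 / form n v w * form n x c) \<cdot>\<^sub>v c"
    using transvection[OF c] by metis
  have "A *\<^sub>v u = u" if "u \<in> U" for u
  proof -
    have u: "u \<in> space_V n" using that U by blast
    then show ?thesis using A(2)[OF u] fc[OF u] eq[OF that] c by (intro eq_vecI) auto
  qed
  then have "A \<in> stab n U" using A(1) by (simp add: stab_def)
  moreover have "A *\<^sub>v v = v + c"
    using A(2)[OF v] fc[OF v] ne c by (simp add: form_self[OF v])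
  then have "A *\<^sub>v v = w" using v w by (auto simp: c_def)
  ultimately show ?thesis by blast
qed

text \<open>
  The transvection along \<open>w - v\<close> needs \<open>(v, w) \<noteq> 0\<close>; otherwise an intermediate vector \<open>z = v + y\<close> with
  \<open>y\<close> orthogonal to \<open>U\<close> but to neither \<open>v\<close> nor \<open>w\<close> is used.
\<close>

lemma stab_transitive:
  fixes U :: "'a :: {field, finite} Matrix.vec set"
  assumes U: "lin_subspace (2 * n) U"
    and v: "v \<in> space_V n" "v \<notin> U" and w: "w \<in> space_V n" "w \<notin> U"
    and eq: "\<And>u. u \<in> U \<Longrightarrow> form n u v = form n u w"
  shows "\<exists>A \<in> stab n U. A *\<^sub>v v = w"
proof (cases "form n v w = 0")
  case False
  then show ?thesis
    using stab_moves_if_not_orthogonal[OF _ v(1) w(1) eq] U by (simp add: lin_subspace_def)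
next
  case True
  have UV: "U \<subseteq> space_V n" using U by (simp add: lin_subspace_def)
  have W: "lin_subspace (2 * n) (perp n U)" by (rule perp_subspace[OF UV])
  note D = lin_subspaceD[OF W]
  \<comment> \<open>A vector outside \<open>U\<close> is outside
    \<open>perp n (perp n U)\<close>.\<close>
  have ex: "\<exists>y \<in> perp n U. form n x y \<noteq> 0" if "x \<in> space_V n" "x \<notin> U" for x
    using that perp_perp[OF U] by (auto simp: perp_def)
  obtain y1 y2 where y: "y1 \<in> perp n U" "form n v y1 \<noteq> 0" "y2 \<in> perp n U" "form n w y2 \<noteq> 0"
    using ex[OF v] ex[OF w] by blast
  have "\<exists>y \<in> perp n U. form n v y \<noteq> 0 \<and> form n w y \<noteq> 0"
  \<comment> \<open>If neither \<open>y1\<close> nor \<open>y2\<close> serves both \<open>v\<close>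
    and \<open>w\<close>, their sum does.\<close>
  proof (cases "form n w y1 = 0 \<and> form n v y2 = 0")
    case True
    then have "form n v (y1 + y2) \<noteq> 0" "form n w (y1 + y2) \<noteq> 0"
      using y v(1) w(1) D(1) by (simp_all add: form_add_right)
    then show ?thesis using D(3) y by blast
  qed (use y in blast)
  then obtain y where y: "y \<in> perp n U" "form n v y \<noteq> 0" "form n w y \<noteq> 0" by blast
  have yV: "y \<in> space_V n" using D(1) y(1) .
  define z where "z = v + y"
  have z: "z \<in> space_V n" using v(1) yV by (simp add: z_def)
  have "form n u y = 0" if "u \<in> U" for u
    using that y(1) UV form_skew[OF yV, of u] by (auto simp: perp_def)
  then have uz: "form n u v = form n u z" if "u \<in> U" for u
    using that v(1) yV UV by (auto simp: z_def form_add_right)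
  have "form n v z \<noteq> 0"
    using v(1) yV y(2) by (simp add: z_def form_add_right form_self)
  then obtain A where A: "A \<in> stab n U" "A *\<^sub>v v = z"
    using stab_moves_if_not_orthogonal[OF UV v(1) z uz] by blast
  have "form n z w \<noteq> 0"
    using v(1) w(1) yV y(3) True form_skew[OF w(1) yV] by (simp add: z_def form_add_left)
  then obtain B where B: "B \<in> stab n U" "B *\<^sub>v z = w"
    using stab_moves_if_not_orthogonal[OF UV z w(1)] uz eq by metis
  have "(B * A) *\<^sub>v v = w"
    using A B by (simp add: stab_def Sp_mult_vec[OF _ _ v(1)])
  then show ?thesis using stab_mult[OF B(1) A(1) UV] by blast
qed

section \<open>Orbit counting outside a subspace\<close>

lemma stab_preserves_fibre:
  assumes U: "lin_subspace (2 * n) U" and A: "A \<in> stab n U"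
    and v: "v \<in> space_V n" "v \<notin> U"
  shows "A *\<^sub>v v \<in> space_V n - U" "u \<in> U \<Longrightarrow> form n u (A *\<^sub>v v) = form n u v"
proof -
  have A': "A \<in> Sp n" "\<And>u. u \<in> U \<Longrightarrow> A *\<^sub>v u = u" using A by (auto simp: stab_def)
  note D = lin_subspaceD[OF U]
  show "A *\<^sub>v v \<in> space_V n - U"
  proof
    show "A *\<^sub>v v \<notin> U"
    proof
      assume *: "A *\<^sub>v v \<in> U"
      have "v = A *\<^sub>v v" by (rule Sp_vec_inj[OF A'(1) v(1) D(1)[OF *]]) (simp add: A'(2)[OF *])
      with * v show False by simp
    qed
  qed (use A' v in simp)
  show "form n u (A *\<^sub>v v) = form n u v" if "u \<in> U"
    using Sp_form[OF A'(1) D(1)[OF that] v(1)] A'(2)[OF that] by simp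
qed

text \<open>Orbit-stabiliser argument: the fibre of \<open>w\<close> is its orbit, the sets of
  \<open>A\<close> with \<open>A *\<^sub>v w = v\<close> partition \<open>stab n U\<close> as
  \<open>v\<close> runs over it, and each has the size of the stabiliser of
  \<open>v\<close>.\<close>

lemma sum_card_stab_fibre:
  fixes U :: "'a :: {field, finite} Matrix.vec set"
  assumes U: "lin_subspace (2 * n) U" and w: "w \<in> space_V n - U"
  shows "(\<Sum>v | v \<in> space_V n - U \<and> (\<forall>u \<in> U. form n u v = form n u w). card (stab n (insert v U))) =
    card (stab n U)"
proof -
  define X where "X = {v \<in> space_V n - U. \<forall>u \<in> U. form n u v = form n u w}"
  have UV: "U \<subseteq> space_V n" using U by (simp add: lin_subspace_def)
  have finX: "finite X"
    by (rule finite_subset[OF _ finite_carrier_vec[of "2 * n"]]) (auto simp: X_def)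
  have inj: "inj_on (\<lambda>A. A * C) S" if "C \<in> stab n U" "S \<subseteq> stab n U" for C S
    using that Sp_mult_right_inj[of _ n _ C] by (auto simp: inj_on_def stab_def subset_iff)
  have eq: "card (stab n (insert v U)) = card {A \<in> stab n U. A *\<^sub>v w = v}" if "v \<in> X" for v
  proof -
    have v: "v \<in> space_V n" "v \<notin> U" "\<And>u. u \<in> U \<Longrightarrow> form n u v = form n u w"
      using that by (auto simp: X_def)
    obtain C where C: "C \<in> stab n U" "C *\<^sub>v w = v"
      using stab_transitive[OF U _ _ v(1,2), of w] v(3) w by auto
    \<comment> \<open>\<open>D\<close> stands in for the inverse of \<open>C\<close>: right
      multiplication by \<open>C\<close> and by \<open>D\<close> gives injections in the two
      directions.\<close>
    obtain D where D: "D \<in> stab n U" "D *\<^sub>v v = w"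
      using stab_transitive[OF U v(1,2), of w] v(3) w by auto
    show ?thesis
    proof (rule antisym)
      show "card (stab n (insert v U)) \<le> card {A \<in> stab n U. A *\<^sub>v w = v}"
      proof (rule card_inj_on_le)
        show "inj_on (\<lambda>A. A * C) (stab n (insert v U))"
          by (rule inj[OF C(1)]) (auto simp: stab_insert)
        show "(\<lambda>A. A * C) ` stab n (insert v U) \<subseteq> {A \<in> stab n U. A *\<^sub>v w = v}"
          using C w stab_mult[OF _ C(1) UV]
          by (auto simp: stab_insert) (auto simp: stab_def Sp_mult_vec)
      qed (simp add: stab_finite)
      show "card {A \<in> stab n U. A *\<^sub>v w = v} \<le> card (stab n (insert v U))"
      proof (rule card_inj_on_le)
        show "inj_on (\<lambda>A. A * D) {A \<in> stab n U. A *\<^sub>v w = v}"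
          by (rule inj[OF D(1)]) auto
        show "(\<lambda>A. A * D) ` {A \<in> stab n U. A *\<^sub>v w = v} \<subseteq> stab n (insert v U)"
          using D v(1) stab_mult[OF _ D(1) UV]
          by (auto simp: stab_insert) (auto simp: stab_def Sp_mult_vec)
      qed (simp add: stab_finite)
    qed
  qed
  have "(\<lambda>A. A *\<^sub>v w) ` stab n U \<subseteq> X"
    using stab_preserves_fibre[OF U] w by (auto simp: X_def)
  then have "(\<Sum>v\<in>X. \<Sum>A | A \<in> stab n U \<and> A *\<^sub>v w = v. 1 :: nat) = (\<Sum>A \<in> stab n U. 1)"
    by (intro sum.group stab_finite finX)
  then have "(\<Sum>v\<in>X. card (stab n (insert v U))) = card (stab n U)"
    by (simp add: eq)
  then show ?thesis by (simp add: X_def)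
qed

text \<open>All fibres in the whole space are translates of \<open>perp n U\<close>, so
  \<open>card_perp\<close> shows that there are \<open>card U\<close> of them. The size bound makes
  each one meet the complement of \<open>U\<close>, where it contributes
  \<open>card (stab n U)\<close>.\<close>

lemma sum_card_stab_outside:
  fixes U :: "'a :: {field, finite} Matrix.vec set"
  assumes U: "lin_subspace (2 * n) U" and small: "card U < CARD('a) ^ n"
  shows "(\<Sum>v \<in> space_V n - U. card (stab n (insert v U))) = card U * card (stab n U)"
proof -
  let ?V = "space_V n :: 'a Matrix.vec set"
  \<comment> \<open>The value 0 off \<open>U\<close> makes equality of functionals on
    \<open>U\<close> plain equality of functions.\<close>
  define f where "f v = (\<lambda>u. if u \<in> U then form n u v else 0)" for v
  have f_eq: "f v = f w \<longleftrightarrow> (\<forall>u \<in> U. form n u v = form n u w)" for v w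
    by (auto simp: f_def fun_eq_iff)
  have UV: "U \<subseteq> ?V" using U by (simp add: lin_subspace_def)
  have W: "lin_subspace (2 * n) (perp n U)" by (rule perp_subspace[OF UV])
  note fin[simp] = lin_subspace_finite[OF U] lin_subspace_finite[OF W]
    finite_carrier_vec[of "2 * n", where ?'b = 'a]
  have perp_f: "f (v + y) = f v \<longleftrightarrow> y \<in> perp n U" if "v \<in> ?V" "y \<in> ?V" for v y
  proof -
    have "form n u (v + y) = form n u v \<longleftrightarrow> form n y u = 0" if "u \<in> U" for u
      using \<open>v \<in> ?V\<close> \<open>y \<in> ?V\<close> that UV form_skew[of y n u] by (auto simp: form_add_right)
    then show ?thesis using that(2) by (auto simp: f_eq perp_def)
  qed
  have fibre: "card {w \<in> ?V. f w = f v} = card (perp n U)" if v: "v \<in> ?V" for v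
  proof -
    have "bij_betw (\<lambda>y. v + y) (perp n U) {w \<in> ?V. f w = f v}"
    proof (rule bij_betw_byWitness[where f' = "\<lambda>w. w - v"])
      have "w - v \<in> perp n U" if "w \<in> ?V" "f w = f v" for w
      proof -
        have "v + (w - v) = w" using v that by (intro eq_vecI) auto
        then show ?thesis using perp_f[OF v, of "w - v"] that v by simp
      qed
      then show "(\<lambda>w. w - v) ` {w \<in> ?V. f w = f v} \<subseteq> perp n U" by auto
      show "(\<lambda>y. v + y) ` perp n U \<subseteq> {w \<in> ?V. f w = f v}"
        using v perp_f[OF v] by (auto simp: perp_def)
    qed (use v in \<open>auto simp: perp_def intro!: eq_vecI\<close>)
    then show ?thesis by (rule bij_betw_same_card[symmetric])
  qed
  have big: "card U < card (perp n U)"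
  proof (rule ccontr)
    assume "\<not> card U < card (perp n U)"
    then have "card U * card (perp n U) \<le> card U * card U" by simp
    also have "\<dots> < CARD('a) ^ n * CARD('a) ^ n" using small by (intro mult_strict_mono) auto
    finally show False using card_perp[OF U] by (simp add: mult_2 power_add)
  qed
  \<comment> \<open>A fibre has more elements than \<open>U\<close>, so it is not contained in
    \<open>U\<close>.\<close>
  have "f ` ?V \<subseteq> f ` (?V - U)"
  proof
    fix g assume "g \<in> f ` ?V"
    then obtain v where v: "v \<in> ?V" "g = f v" by blast
    have "\<not> {w \<in> ?V. f w = f v} \<subseteq> U"
      using card_mono[OF fin(1), of "{w \<in> ?V. f w = f v}"] fibre[OF v(1)] big by auto
    then show "g \<in> f ` (?V - U)" using v(2) by (auto intro: rev_image_eqI)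
  qed
  then have im: "f ` (?V - U) = f ` ?V" by blast
  have "card ?V = (\<Sum>g \<in> f ` ?V. card {w \<in> ?V. f w = g})"
    using sum.image_gen[of ?V "\<lambda>_. 1 :: nat" f] by simp
  also have "\<dots> = (\<Sum>g \<in> f ` ?V. card (perp n U))" using fibre by (intro sum.cong) auto
  finally have "card U * card (perp n U) = card (f ` ?V) * card (perp n U)"
    using card_perp[OF U] by (simp add: card_carrier_vec)
  then have imU: "card (f ` ?V) = card U" using big by (metis mult_cancel2 not_less_zero)
  have "(\<Sum>v \<in> ?V - U. card (stab n (insert v U))) =
      (\<Sum>g \<in> f ` (?V - U). \<Sum>v | v \<in> ?V - U \<and> f v = g. card (stab n (insert v U)))"
    by (rule sum.image_gen) simp
  also have "\<dots> = (\<Sum>g \<in> f ` (?V - U). card (stab n U))"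
    using sum_card_stab_fibre[OF U] by (intro sum.cong refl) (auto simp: f_eq)
  finally show ?thesis by (simp add: im imU)
qed

section \<open>The induction on the moment\<close>

text \<open>The size hypothesis expresses \<open>dim U + j \<le> n\<close>. It survives trading one
  unit of \<open>j\<close> for the vector adjoined to \<open>U\<close>, and for positive
  \<open>j\<close> it yields the strict bound that the orbit count requires.\<close>

lemma sum_num_fixed_vecs_power:
  fixes U :: "'a :: {field, finite} Matrix.vec set"
  assumes "lin_subspace (2 * n) U" "card U * CARD('a) ^ j \<le> CARD('a) ^ n"
  shows "(\<Sum>A \<in> stab n U. num_fixed_vecs n A ^ j) =
    card U ^ j * card (stab n U) * (\<Prod>i<j. CARD('a) ^ i + 1)"
  using assms
proof (induction j arbitrary: U)
  case (Suc j)
  let ?V = "space_V n :: 'a Matrix.vec set" and ?q = "CARD('a)"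
  let ?P = "\<Prod>i<j. ?q ^ i + 1"
  note U = Suc.prems(1)
  have UV: "U \<subseteq> ?V" using U by (simp add: lin_subspace_def)
  have finV: "finite ?V" by (rule finite_carrier_vec)
  have q: "?q > 1" using card_mono[of "UNIV :: 'a set" "{0, 1}"] by simp
  have U0: "card U > 0"
    using lin_subspaceD(2)[OF U] lin_subspace_finite[OF U] by (auto simp: card_gt_0_iff)
  have small: "card U < ?q ^ n"
  proof -
    have "card U * 1 < card U * ?q ^ Suc j" using q U0 by (intro mult_strict_left_mono one_less_power) auto
    from less_le_trans[OF this Suc.prems(2)] show ?thesis by simp
  qed
  have adj: "card (adjoin U v) = (if v \<in> U then card U else ?q * card U)" if "v \<in> ?V" for v
    using card_adjoin[OF U that] adjoin_member[OF U] by simp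
  have step: "(\<Sum>A \<in> stab n (adjoin U v). num_fixed_vecs n A ^ j) =
      card (adjoin U v) ^ j * card (stab n (insert v U)) * ?P" if v: "v \<in> ?V" for v
  proof -
    have "card (adjoin U v) * ?q ^ j \<le> card U * ?q ^ Suc j" using q by (simp add: adj[OF v])
    also note Suc.prems(2)
    finally show ?thesis using Suc.IH[OF adjoin_subspace[OF U v]] by (simp add: stab_adjoin[OF U v])
  qed
  have "(\<Sum>A \<in> stab n U. num_fixed_vecs n A ^ Suc j) =
      (\<Sum>A \<in> stab n U. \<Sum>v | v \<in> ?V \<and> A *\<^sub>v v = v. num_fixed_vecs n A ^ j)"
    by (simp add: num_fixed_vecs_def)
  also have "\<dots> = (\<Sum>v \<in> ?V. \<Sum>A | A \<in> stab n U \<and> A *\<^sub>v v = v. num_fixed_vecs n A ^ j)"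
    by (rule sum.swap_restrict[OF stab_finite finV])
  also have "\<dots> = (\<Sum>v \<in> ?V. card (adjoin U v) ^ j * card (stab n (insert v U)) * ?P)"
    using step by (intro sum.cong refl) (simp only: stab_adjoin[OF U] stab_insert)
  also have "\<dots> = (\<Sum>v \<in> U. card (adjoin U v) ^ j * card (stab n (insert v U)) * ?P) +
      (\<Sum>v \<in> ?V - U. card (adjoin U v) ^ j * card (stab n (insert v U)) * ?P)"
    using sum.subset_diff[OF UV finV] by (simp add: add.commute)
  also have "(\<Sum>v \<in> U. card (adjoin U v) ^ j * card (stab n (insert v U)) * ?P) =
      (\<Sum>v \<in> U. card U ^ j * card (stab n U) * ?P)"
    using UV by (intro sum.cong refl) (auto simp: adj insert_absorb)
  also have "(\<Sum>v \<in> ?V - U. card (adjoin U v) ^ j * card (stab n (insert v U)) * ?P) =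
      (\<Sum>v \<in> ?V - U. (?q * card U) ^ j * ?P * card (stab n (insert v U)))"
    by (intro sum.cong refl) (auto simp: adj)
  also have "\<dots> = (?q * card U) ^ j * ?P * (card U * card (stab n U))"
    by (simp only: sum_distrib_left[symmetric] sum_card_stab_outside[OF U small])
  \<comment> \<open>The two parts are \<open>card U ^ Suc j * card (stab n U) * ?P\<close>, once
    with factor 1 from \<open>U\<close> and once with factor \<open>?q ^ j\<close> from its
    complement. Together they supply the new factor \<open>?q ^ j + 1\<close>.\<close>
  finally show ?case by (simp add: algebra_simps power_mult_distrib)
qed simp

theorem theorem4p4:
  fixes q n j :: nat
  assumes "primepow q"
    and "CARD('a :: {field, finite}) = q"
    and "n \<ge> j"
  shows "measure_pmf.expectation (pmf_of_set (Sp n :: 'a mat set))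
           (\<lambda>g. real (num_fixed_vecs n g) ^ j)
         = (\<Prod>i = 1..j. real q ^ (i - 1) + 1)"
proof -
  let ?U = "{0\<^sub>v (2 * n)} :: 'a Matrix.vec set"
  have U: "lin_subspace (2 * n) ?U" by (auto simp: lin_subspace_def)
  have stab: "stab n ?U = Sp n"
    using mult_mat_zero_vec[OF Sp_carrier] by (auto simp: stab_def)
  have "card ?U * CARD('a) ^ j \<le> CARD('a) ^ n" using assms(3) by (simp add: power_increasing Suc_leI)
  then have "(\<Sum>A \<in> (Sp n :: 'a mat set). num_fixed_vecs n A ^ j) =
      card (Sp n :: 'a mat set) * (\<Prod>i<j. q ^ i + 1)"
    using sum_num_fixed_vecs_power[OF U] assms(2) by (simp add: stab)
  then have "real (\<Sum>A \<in> (Sp n :: 'a mat set). num_fixed_vecs n A ^ j) =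
      real (card (Sp n :: 'a mat set) * (\<Prod>i<j. q ^ i + 1))"
    by (rule arg_cong)
  then have "(\<Sum>A \<in> (Sp n :: 'a mat set). real (num_fixed_vecs n A) ^ j) =
      real (card (Sp n :: 'a mat set)) * (\<Prod>i<j. real q ^ i + 1)"
    by (simp add: add.commute)
  moreover have "card (Sp n :: 'a mat set) \<noteq> 0" by (simp add: card_eq_0_iff finite_Sp Sp_nonempty)
  \<comment> \<open>The expectation is the sum divided by the group order;
    \<open>prod.atLeast1_atMost_eq\<close> shifts the index from \<open>1..j\<close> to
    \<open>i < j\<close>.\<close>
  ultimately show ?thesis
    by (simp add: integral_pmf_of_set[OF Sp_nonempty finite_Sp] prod.atLeast1_atMost_eq)
qed

end
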